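(* Let $\Gamma=A*B$ be a free product of groups such that $|A|\ge 2$ and $B$ contains an element $b$ of order at least $3$. Let $a$ be a non-trivial element of $A$ and let $\Gamma_0=\langle ab\rangle$. Then $\Gamma_0$ is malnormal in $\Gamma$.
   Context: A subgroup $\Gamma_0$ of $\Gamma$ is malnormal if $g\Gamma_0g^{-1}\cap\Gamma_0=\{1\}$ for every $g\in\Gamma\setminus\Gamma_0$. The order of $b$ may be infinite. *)

theory Defs
  imports "HOL-Algebra.Algebra"
begin

section \<open>The free product of two groups\<close>

text \<open>
  The elements of \<open>A * B\<close> are the reduced words: lists whose letters are non-trivial elements
  of \<open>A\<close> (tagged \<open>Inl\<close>) and of \<open>B\<close> (tagged \<open>Inr\<close>), with consecutive letters from different
  factors. The product of two reduced words is the reduced form of their concatenation.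
  Theorem \<open>free_product_universal\<close> shows that this is the coproduct of groups.
\<close>

fun nontrivial_letter :: "('a, 'm) monoid_scheme \<Rightarrow> ('b, 'n) monoid_scheme \<Rightarrow> 'a + 'b \<Rightarrow> bool" where
  "nontrivial_letter A B (Inl a) \<longleftrightarrow> a \<in> carrier A \<and> a \<noteq> \<one>\<^bsub>A\<^esub>"
| "nontrivial_letter A B (Inr b) \<longleftrightarrow> b \<in> carrier B \<and> b \<noteq> \<one>\<^bsub>B\<^esub>"

definition reduced_word ::
    "('a, 'm) monoid_scheme \<Rightarrow> ('b, 'n) monoid_scheme \<Rightarrow> ('a + 'b) list \<Rightarrow> bool" where
  "reduced_word A B w \<longleftrightarrow>
     (\<forall>x\<in>set w. nontrivial_letter A B x) \<and> successively (\<lambda>x y. isl x \<noteq> isl y) w"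

text \<open>Left multiplication of a reduced word by a non-trivial letter.\<close>

fun letter_mult ::
    "('a, 'm) monoid_scheme \<Rightarrow> ('b, 'n) monoid_scheme \<Rightarrow> 'a + 'b \<Rightarrow> ('a + 'b) list \<Rightarrow> ('a + 'b) list"
where
  "letter_mult A B (Inl a) (Inl a' # w) =
     (if a \<otimes>\<^bsub>A\<^esub> a' = \<one>\<^bsub>A\<^esub> then w else Inl (a \<otimes>\<^bsub>A\<^esub> a') # w)"
| "letter_mult A B (Inr b) (Inr b' # w) =
     (if b \<otimes>\<^bsub>B\<^esub> b' = \<one>\<^bsub>B\<^esub> then w else Inr (b \<otimes>\<^bsub>B\<^esub> b') # w)"
| "letter_mult A B x w = x # w"

definition free_product ::
    "('a, 'm) monoid_scheme \<Rightarrow> ('b, 'n) monoid_scheme \<Rightarrow> ('a + 'b) list monoid" where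
  "free_product A B =
     \<lparr>carrier = {w. reduced_word A B w}, monoid.mult = foldr (letter_mult A B), one = []\<rparr>"

definition free_inl :: "('a, 'm) monoid_scheme \<Rightarrow> 'a \<Rightarrow> ('a + 'b) list" where
  "free_inl A a = (if a = \<one>\<^bsub>A\<^esub> then [] else [Inl a])"

definition free_inr :: "('b, 'n) monoid_scheme \<Rightarrow> 'b \<Rightarrow> ('a + 'b) list" where
  "free_inr B b = (if b = \<one>\<^bsub>B\<^esub> then [] else [Inr b])"


section \<open>Malnormal subgroups\<close>

definition malnormal :: "'a set \<Rightarrow> ('a, 'm) monoid_scheme \<Rightarrow> bool" where
  "malnormal H G \<longleftrightarrow> subgroup H G \<and>
     (\<forall>g \<in> carrier G - H. (g <#\<^bsub>G\<^esub> H #>\<^bsub>G\<^esub> inv\<^bsub>G\<^esub> g) \<inter> H = {\<one>\<^bsub>G\<^esub>})"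


section \<open>The free product is a group and has the universal property\<close>

lemma reduced_word_Nil [simp]: "reduced_word A B []"
  by (simp add: reduced_word_def)

lemma reduced_word_Cons:
  "reduced_word A B (x # w) \<longleftrightarrow>
     nontrivial_letter A B x \<and> reduced_word A B w \<and> (w = [] \<or> isl x \<noteq> isl (hd w))"
  by (auto simp: reduced_word_def successively_Cons)

lemma free_product_simps [simp]:
  "w \<in> carrier (free_product A B) \<longleftrightarrow> reduced_word A B w"
  "\<one>\<^bsub>free_product A B\<^esub> = []"
  "u \<otimes>\<^bsub>free_product A B\<^esub> v = foldr (letter_mult A B) u v"
  by (simp_all add: free_product_def)

locale two_groups = A: group A + B: group B
  for A :: "('a, 'm) monoid_scheme" and B :: "('b, 'n) monoid_scheme"
begin

lemma reduced_letter_mult: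
  assumes "nontrivial_letter A B x" "reduced_word A B w"
  shows "reduced_word A B (letter_mult A B x w)"
  using assms
  by (cases "(A, B, x, w)" rule: letter_mult.cases) (auto simp: reduced_word_Cons)

lemma reduced_mult:
  assumes "reduced_word A B u" "reduced_word A B v"
  shows "reduced_word A B (foldr (letter_mult A B) u v)"
  using assms by (induction u) (auto simp: reduced_word_Cons reduced_letter_mult)

lemma mult_Nil_right:
  "reduced_word A B u \<Longrightarrow> foldr (letter_mult A B) u [] = u"
proof (induction u)
  case (Cons x u)
  then show ?case
    by (cases "(A, B, x, u)" rule: letter_mult.cases) (auto simp: reduced_word_Cons)
qed simp

lemma letter_mult_InlInl:
  assumes "a \<in> carrier A" "a \<noteq> \<one>\<^bsub>A\<^esub>" "a' \<in> carrier A" "a' \<noteq> \<one>\<^bsub>A\<^esub>" "reduced_word A B w"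
  shows "letter_mult A B (Inl a) (letter_mult A B (Inl a') w) =
    (if a \<otimes>\<^bsub>A\<^esub> a' = \<one>\<^bsub>A\<^esub> then w else letter_mult A B (Inl (a \<otimes>\<^bsub>A\<^esub> a')) w)"
proof (cases "\<exists>c v. w = Inl c # v")
  case True
  then obtain c v where w: "w = Inl c # v" by blast
  then have c: "c \<in> carrier A" "c \<noteq> \<one>\<^bsub>A\<^esub>"
    and v: "v = [] \<or> isl (Inl c :: 'a + 'b) \<noteq> isl (hd v)"
    using assms(5) by (simp_all add: reduced_word_Cons)
  have lv: "letter_mult A B (Inl a) v = Inl a # v"
  proof (cases v)
    case (Cons y v')
    then show ?thesis using v by (cases y) simp_all
  qed simp
  have assoc: "a \<otimes>\<^bsub>A\<^esub> a' \<otimes>\<^bsub>A\<^esub> c = a \<otimes>\<^bsub>A\<^esub> (a' \<otimes>\<^bsub>A\<^esub> c)"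
    using assms c by (simp add: A.m_assoc)
  show ?thesis
  proof (cases "a' \<otimes>\<^bsub>A\<^esub> c = \<one>\<^bsub>A\<^esub>")
    case inv_c: True
    then have "a \<otimes>\<^bsub>A\<^esub> a' \<otimes>\<^bsub>A\<^esub> c = a" using assoc assms(1) by simp
    moreover have "a = c" if "a \<otimes>\<^bsub>A\<^esub> a' = \<one>\<^bsub>A\<^esub>"
      using that calculation c by simp
    ultimately show ?thesis using lv inv_c assms(2) by (auto simp: w)
  next
    case False
    have "a \<otimes>\<^bsub>A\<^esub> (a' \<otimes>\<^bsub>A\<^esub> c) = c" if "a \<otimes>\<^bsub>A\<^esub> a' = \<one>\<^bsub>A\<^esub>"
      using that assoc c by simp
    then show ?thesis using False assoc c by (auto simp: w)
  qed
next
  case False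
  then have "letter_mult A B (Inl y) w = Inl y # w" for y
    by (cases w rule: list.exhaust; cases "hd w") auto
  then show ?thesis by simp
qed

lemma letter_mult_InrInr:
  assumes "b \<in> carrier B" "b \<noteq> \<one>\<^bsub>B\<^esub>" "b' \<in> carrier B" "b' \<noteq> \<one>\<^bsub>B\<^esub>" "reduced_word A B w"
  shows "letter_mult A B (Inr b) (letter_mult A B (Inr b') w) =
    (if b \<otimes>\<^bsub>B\<^esub> b' = \<one>\<^bsub>B\<^esub> then w else letter_mult A B (Inr (b \<otimes>\<^bsub>B\<^esub> b')) w)"
proof (cases "\<exists>c v. w = Inr c # v")
  case True
  then obtain c v where w: "w = Inr c # v" by blast
  then have c: "c \<in> carrier B" "c \<noteq> \<one>\<^bsub>B\<^esub>"
    and v: "v = [] \<or> isl (Inr c :: 'a + 'b) \<noteq> isl (hd v)"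
    using assms(5) by (simp_all add: reduced_word_Cons)
  have lv: "letter_mult A B (Inr b) v = Inr b # v"
  proof (cases v)
    case (Cons y v')
    then show ?thesis using v by (cases y) simp_all
  qed simp
  have assoc: "b \<otimes>\<^bsub>B\<^esub> b' \<otimes>\<^bsub>B\<^esub> c = b \<otimes>\<^bsub>B\<^esub> (b' \<otimes>\<^bsub>B\<^esub> c)"
    using assms c by (simp add: B.m_assoc)
  show ?thesis
  proof (cases "b' \<otimes>\<^bsub>B\<^esub> c = \<one>\<^bsub>B\<^esub>")
    case inv_c: True
    then have "b \<otimes>\<^bsub>B\<^esub> b' \<otimes>\<^bsub>B\<^esub> c = b" using assoc assms(1) by simp
    moreover have "b = c" if "b \<otimes>\<^bsub>B\<^esub> b' = \<one>\<^bsub>B\<^esub>"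
      using that calculation c by simp
    ultimately show ?thesis using lv inv_c assms(2) by (auto simp: w)
  next
    case False
    have "b \<otimes>\<^bsub>B\<^esub> (b' \<otimes>\<^bsub>B\<^esub> c) = c" if "b \<otimes>\<^bsub>B\<^esub> b' = \<one>\<^bsub>B\<^esub>"
      using that assoc c by simp
    then show ?thesis using False assoc c by (auto simp: w)
  qed
next
  case False
  then have "letter_mult A B (Inr y) w = Inr y # w" for y
    by (cases w rule: list.exhaust; cases "hd w") auto
  then show ?thesis by simp
qed

lemma foldr_letter_mult:
  assumes "nontrivial_letter A B x" "reduced_word A B v" "reduced_word A B w"
  shows "foldr (letter_mult A B) (letter_mult A B x v) w =
    letter_mult A B x (foldr (letter_mult A B) v w)"
  using assms
  by (cases "(A, B, x, v)" rule: letter_mult.cases)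
    (auto simp: reduced_word_Cons letter_mult_InlInl letter_mult_InrInr reduced_mult)

lemma mult_assoc:
  assumes "reduced_word A B u" "reduced_word A B v" "reduced_word A B w"
  shows "foldr (letter_mult A B) (foldr (letter_mult A B) u v) w =
    foldr (letter_mult A B) u (foldr (letter_mult A B) v w)"
  using assms by (induction u) (auto simp: reduced_word_Cons foldr_letter_mult reduced_mult)

lemma left_inverse:
  assumes "reduced_word A B u"
  shows "\<exists>v. reduced_word A B v \<and> foldr (letter_mult A B) v u = []"
  using assms
proof (induction u)
  case Nil
  show ?case by (rule exI[of _ "[]"]) simp
next
  case (Cons x u)
  then have x: "nontrivial_letter A B x" and u: "reduced_word A B u"
    by (auto simp: reduced_word_Cons)
  from Cons.IH[OF u] obtain v
    where v: "reduced_word A B v" "foldr (letter_mult A B) v u = []" by blast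
  obtain y where y: "nontrivial_letter A B y" "letter_mult A B y (x # u) = u"
  proof (cases x)
    case (Inl a)
    then show ?thesis using x by (intro that[of "Inl (inv\<^bsub>A\<^esub> a)"]) auto
  next
    case (Inr b)
    then show ?thesis using x by (intro that[of "Inr (inv\<^bsub>B\<^esub> b)"]) auto
  qed
  have ry: "reduced_word A B [y]" using y by (simp add: reduced_word_Cons)
  show ?case
    using mult_assoc[OF v(1) ry Cons.prems] reduced_mult[OF v(1) ry] v(2) y(2)
    by (intro exI[of _ "foldr (letter_mult A B) v [y]"]) simp
qed

end

theorem group_free_product:
  assumes "group A" "group B"
  shows "group (free_product A B)"
proof -
  interpret two_groups A B using assms by (simp add: two_groups_def)
  show ?thesis
    by (rule groupI) (auto simp: reduced_mult mult_assoc Bex_def left_inverse)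
qed

theorem free_inl_hom:
  assumes "group A" "group B"
  shows "free_inl A \<in> hom A (free_product A B)"
proof -
  interpret two_groups A B using assms by (simp add: two_groups_def)
  show ?thesis
    by (auto simp: hom_def free_inl_def reduced_word_Cons)
qed

theorem free_inr_hom:
  assumes "group A" "group B"
  shows "free_inr B \<in> hom B (free_product A B)"
proof -
  interpret two_groups A B using assms by (simp add: two_groups_def)
  show ?thesis
    by (auto simp: hom_def free_inr_def reduced_word_Cons)
qed

theorem free_product_universal:
  fixes A :: "('a, 'm) monoid_scheme" and B :: "('b, 'n) monoid_scheme"
    and K :: "('k, 'p) monoid_scheme"
  assumes "group A" "group B" "group K" and f: "f \<in> hom A K" and g: "g \<in> hom B K"
  shows "\<exists>h \<in> hom (free_product A B) K.
      (\<forall>a \<in> carrier A. h (free_inl A a) = f a) \<and> (\<forall>b \<in> carrier B. h (free_inr B b) = g b) \<and>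
      (\<forall>h' \<in> hom (free_product A B) K.
        (\<forall>a \<in> carrier A. h' (free_inl A a) = f a) \<and> (\<forall>b \<in> carrier B. h' (free_inr B b) = g b) \<longrightarrow>
        (\<forall>w \<in> carrier (free_product A B). h' w = h w))"
proof -
  interpret two_groups A B using assms by (simp add: two_groups_def)
  interpret K: group K by fact
  interpret f: group_hom A K f using f by unfold_locales
  interpret g: group_hom B K g using g by unfold_locales
  interpret F: group "free_product A B" using assms by (intro group_free_product)
  define h where "h = foldr (\<lambda>x z. case_sum f g x \<otimes>\<^bsub>K\<^esub> z)"
  have closed: "h w \<one>\<^bsub>K\<^esub> \<in> carrier K" if "reduced_word A B w" for w
    using that by (induction w) (auto simp: h_def reduced_word_Cons split: sum.splits)
  have h_Cons: "h (x # w) z = case_sum f g x \<otimes>\<^bsub>K\<^esub> h w z" for x w z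
    by (simp add: h_def)
  have letter: "h (letter_mult A B x w) \<one>\<^bsub>K\<^esub> = case_sum f g x \<otimes>\<^bsub>K\<^esub> h w \<one>\<^bsub>K\<^esub>"
    if "nontrivial_letter A B x" "reduced_word A B w" for x w
  proof (cases "(A, B, x, w)" rule: letter_mult.cases)
    case (1 A' B' a a' v)
    then have a: "a \<in> carrier A" "a' \<in> carrier A" "reduced_word A B v"
      and xw: "x = Inl a" "w = Inl a' # v"
      using that by (simp_all add: reduced_word_Cons)
    have "f (a \<otimes>\<^bsub>A\<^esub> a') \<otimes>\<^bsub>K\<^esub> h v \<one>\<^bsub>K\<^esub> = f a \<otimes>\<^bsub>K\<^esub> (f a' \<otimes>\<^bsub>K\<^esub> h v \<one>\<^bsub>K\<^esub>)"
      using a closed[OF a(3)] by (simp add: K.m_assoc)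
    moreover have "f (a \<otimes>\<^bsub>A\<^esub> a') \<otimes>\<^bsub>K\<^esub> h v \<one>\<^bsub>K\<^esub> = h v \<one>\<^bsub>K\<^esub>" if "a \<otimes>\<^bsub>A\<^esub> a' = \<one>\<^bsub>A\<^esub>"
      using closed[OF a(3)] by (simp only: that f.hom_one K.l_one)
    ultimately have "h v \<one>\<^bsub>K\<^esub> = f a \<otimes>\<^bsub>K\<^esub> (f a' \<otimes>\<^bsub>K\<^esub> h v \<one>\<^bsub>K\<^esub>)" if "a \<otimes>\<^bsub>A\<^esub> a' = \<one>\<^bsub>A\<^esub>"
      using that by metis
    then show ?thesis using a closed[OF a(3)] by (simp add: xw h_Cons K.m_assoc)
  next
    case (2 A' B' b b' v)
    then have b: "b \<in> carrier B" "b' \<in> carrier B" "reduced_word A B v"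
      and xw: "x = Inr b" "w = Inr b' # v"
      using that by (simp_all add: reduced_word_Cons)
    have "g (b \<otimes>\<^bsub>B\<^esub> b') \<otimes>\<^bsub>K\<^esub> h v \<one>\<^bsub>K\<^esub> = g b \<otimes>\<^bsub>K\<^esub> (g b' \<otimes>\<^bsub>K\<^esub> h v \<one>\<^bsub>K\<^esub>)"
      using b closed[OF b(3)] by (simp add: K.m_assoc)
    moreover have "g (b \<otimes>\<^bsub>B\<^esub> b') \<otimes>\<^bsub>K\<^esub> h v \<one>\<^bsub>K\<^esub> = h v \<one>\<^bsub>K\<^esub>" if "b \<otimes>\<^bsub>B\<^esub> b' = \<one>\<^bsub>B\<^esub>"
      using closed[OF b(3)] by (simp only: that g.hom_one K.l_one)
    ultimately have "h v \<one>\<^bsub>K\<^esub> = g b \<otimes>\<^bsub>K\<^esub> (g b' \<otimes>\<^bsub>K\<^esub> h v \<one>\<^bsub>K\<^esub>)" if "b \<otimes>\<^bsub>B\<^esub> b' = \<one>\<^bsub>B\<^esub>"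
      using that by metis
    then show ?thesis using b closed[OF b(3)] by (simp add: xw h_Cons K.m_assoc)
  qed (auto simp: h_def)
  have mult: "h (foldr (letter_mult A B) u v) \<one>\<^bsub>K\<^esub> = h u \<one>\<^bsub>K\<^esub> \<otimes>\<^bsub>K\<^esub> h v \<one>\<^bsub>K\<^esub>"
    if "reduced_word A B u" "reduced_word A B v" for u v
    using that(1)
  proof (induction u)
    case Nil
    then show ?case using closed[OF that(2)] by (simp add: h_def)
  next
    case (Cons x u)
    then have x: "nontrivial_letter A B x" and u: "reduced_word A B u"
      by (auto simp: reduced_word_Cons)
    have "case_sum f g x \<in> carrier K" using x by (cases x) auto
    moreover have "h (x # u) \<one>\<^bsub>K\<^esub> = case_sum f g x \<otimes>\<^bsub>K\<^esub> h u \<one>\<^bsub>K\<^esub>" by (simp add: h_def)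
    ultimately show ?case
      using letter[OF x reduced_mult[OF u that(2)]] Cons.IH[OF u] closed[OF u] closed[OF that(2)]
      by (simp add: K.m_assoc)
  qed
  show ?thesis
  proof (intro bexI[of _ "\<lambda>w. h w \<one>\<^bsub>K\<^esub>"] conjI ballI impI)
    show "(\<lambda>w. h w \<one>\<^bsub>K\<^esub>) \<in> hom (free_product A B) K"
      by (auto simp: hom_def closed mult)
    show "h (free_inl A a) \<one>\<^bsub>K\<^esub> = f a" if "a \<in> carrier A" for a
      using that by (auto simp: h_def free_inl_def)
    show "h (free_inr B b) \<one>\<^bsub>K\<^esub> = g b" if "b \<in> carrier B" for b
      using that by (auto simp: h_def free_inr_def)
  next
    fix h' w
    assume h': "h' \<in> hom (free_product A B) K"
      and eq: "(\<forall>a \<in> carrier A. h' (free_inl A a) = f a) \<and> (\<forall>b \<in> carrier B. h' (free_inr B b) = g b)"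
      and w: "w \<in> carrier (free_product A B)"
    interpret h': group_hom "free_product A B" K h' using h' by unfold_locales
    from w have "reduced_word A B w" by simp
    then show "h' w = h w \<one>\<^bsub>K\<^esub>"
    proof (induction w)
      case Nil
      then show ?case using h'.hom_one by (simp add: h_def)
    next
      case (Cons x w)
      then have x: "nontrivial_letter A B x" and rw: "reduced_word A B w"
        by (auto simp: reduced_word_Cons)
      have rx: "reduced_word A B [x]" using x by (simp add: reduced_word_Cons)
      have "letter_mult A B x w = x # w"
        using Cons.prems
        by (cases "(A, B, x, w)" rule: letter_mult.cases) (auto simp: reduced_word_Cons)
      then have "h' (x # w) = h' [x] \<otimes>\<^bsub>K\<^esub> h' w"
        using h'.hom_mult[of "[x]" w] rx rw by simp
      moreover have "h' [x] = case_sum f g x"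
        using eq x by (cases x) (auto simp: free_inl_def free_inr_def dest!: bspec)
      ultimately show ?case using Cons.IH[OF rw] by (simp add: h_def)
    qed
  qed
qed

end

theory Submission
  imports Defs
begin

text \<open>
  Write \<open>t = ab\<close>, a reduced word of length two, and suppose that \<open>g t\<^sup>n g\<inverse> = t\<^sup>m\<close> with
  \<open>n \<noteq> 0\<close>; inverting both sides if necessary, \<open>n > 0\<close>. Then \<open>g t\<^bsup>nk\<^esup> = t\<^bsup>mk\<^esup> g\<close> for every \<open>k\<close>.
  Multiplication by \<open>g\<close> disturbs only about \<open>|g|\<close> letters at one end of a word
  (\<open>mult_keeps_suffix\<close>, \<open>mult_keeps_prefix\<close>), so once \<open>k\<close> exceeds \<open>|g|\<close> the left-hand side is
  a short word followed by a long suffix of \<open>ababab\<dots>\<close>, while the right-hand side is a long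
  prefix of \<open>t\<^bsup>mk\<^esup>\<close> followed by a short word, and the two undisturbed stretches overlap in at
  least two letters.

  If \<open>m > 0\<close>, the overlap fixes the parity and the short word is itself a prefix of
  \<open>ababab\<dots>\<close>. Hence \<open>g t\<^bsup>nk\<^esup>\<close> is an alternating word in \<open>a\<close> and \<open>b\<close> from beginning to
  end, that is, a power of \<open>t\<close>, and so \<open>g\<close> is a power of \<open>t\<close>. If \<open>m < 0\<close>, the overlap
  contains a letter from \<open>B\<close> which equals both \<open>b\<close> and \<open>b\<inverse>\<close>; this is impossible because
  the order of \<open>b\<close> is neither 1 nor 2. Finally \<open>m = 0\<close> is impossible because \<open>t\<close> has
  infinite order.
\<close>

section \<open>Cancellation in products of reduced words\<close>

lemma letter_mult_eq_Cons:
  "w = [] \<or> isl x \<noteq> isl (hd w) \<Longrightarrow> letter_mult A B x w = x # w"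
  by (cases "(A, B, x, w)" rule: letter_mult.cases) auto

lemma mult_eq_append:
  "successively (\<lambda>x y. isl x \<noteq> isl y) (u @ v) \<Longrightarrow> foldr (letter_mult A B) u v = u @ v"
proof (induction u)
  case (Cons x u)
  then show ?case
    by (auto simp: successively_Cons letter_mult_eq_Cons)
qed simp

lemma letter_mult_Cons_cases:
  obtains "letter_mult A B x (y # w) = w"
  | z where "isl z = isl y" "letter_mult A B x (y # w) = z # w"
  | "isl x \<noteq> isl y" "letter_mult A B x (y # w) = x # y # w"
proof (cases "isl x = isl y")
  case True
  show thesis
  proof (cases "(A, B, x, y # w)" rule: letter_mult.cases)
    case (1 A' B' c c' v)
    then show thesis using that(1) that(2)[of "Inl (c \<otimes>\<^bsub>A\<^esub> c')"]
      by (cases "c \<otimes>\<^bsub>A\<^esub> c' = \<one>\<^bsub>A\<^esub>") auto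
  next
    case (2 A' B' c c' v)
    then show thesis using that(1) that(2)[of "Inr (c \<otimes>\<^bsub>B\<^esub> c')"]
      by (cases "c \<otimes>\<^bsub>B\<^esub> c' = \<one>\<^bsub>B\<^esub>") auto
  qed (use True in auto)
next
  case False
  then show thesis using that(3) by (simp add: letter_mult_eq_Cons)
qed

text \<open>
  Each letter of \<open>g\<close> consumes at most one letter of \<open>v\<close>, by cancelling or merging with it, and
  creates at most one new letter.
\<close>

lemma mult_keeps_suffix:
  "\<exists>w j. length w \<le> length g \<and> j \<le> length g \<and> foldr (letter_mult A B) g v = w @ drop j v"
proof (induction g)
  case Nil
  show ?case by (auto intro: exI[of _ "[]"] exI[of _ 0])
next
  case (Cons x g)
  then obtain w j where w: "length w \<le> length g" "j \<le> length g"
    and eq: "foldr (letter_mult A B) g v = w @ drop j v" by blast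
  show ?case
  proof (cases w)
    case (Cons y w')
    obtain u where "length u \<le> 2" "letter_mult A B x (y # (w' @ drop j v)) = u @ w' @ drop j v"
      by (rule letter_mult_Cons_cases[of A B x y "w' @ drop j v"])
        (auto intro: that[of "[]"] that[of "[_]"] that[of "[_, _]"])
    then show ?thesis using w eq Cons
      by (intro exI[of _ "u @ w'"] exI[of _ j]) auto
  next
    case Nil
    show ?thesis
    proof (cases "drop j v")
      case Nil': Nil
      then show ?thesis using w eq Nil
        by (intro exI[of _ "[x]"] exI[of _ j]) (auto simp: letter_mult_eq_Cons)
    next
      case (Cons y v')
      then have v': "v' = drop (Suc j) v" by (metis drop_Suc list.sel(3) tl_drop)
      have "\<exists>u k. length u \<le> 1 \<and> k \<le> Suc j \<and> letter_mult A B x (drop j v) = u @ drop k v"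
      proof (rule letter_mult_Cons_cases[of A B x y v'])
        assume "letter_mult A B x (y # v') = v'"
        then show ?thesis unfolding Cons v'
          by (intro exI[of _ "[]"] exI[of _ "Suc j"]) simp
      next
        fix z assume "letter_mult A B x (y # v') = z # v'"
        then show ?thesis unfolding Cons v'
          by (intro exI[of _ "[z]"] exI[of _ "Suc j"]) simp
      next
        assume "letter_mult A B x (y # v') = x # y # v'"
        then have "letter_mult A B x (drop j v) = [x] @ drop j v" unfolding Cons by simp
        then show ?thesis by (intro exI[of _ "[x]"] exI[of _ j]) simp
      qed
      then obtain u k where "length u \<le> 1" "k \<le> Suc j"
        "letter_mult A B x (drop j v) = u @ drop k v" by blast
      then show ?thesis using w eq Nil by (intro exI[of _ u] exI[of _ k]) auto
    qed
  qed
qed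

text \<open>
  A letter multiplied from the right meets only the last letter of \<open>u\<close>: if the two cancel,
  nothing is left to multiply, and if they merge, the result stays in the same factor and so
  still differs in type from its left neighbour.
\<close>

lemma mult_last_letter:
  assumes "reduced_word A B u"
  shows "\<exists>w i. length u \<le> Suc i \<and> i \<le> length u \<and>
    foldr (letter_mult A B) u [x] = take i u @ w"
proof (cases u rule: rev_cases)
  case Nil
  then show ?thesis by (auto intro: exI[of _ "[x]"] exI[of _ 0])
next
  case (snoc u' y)
  have alt: "successively (\<lambda>x y. isl x \<noteq> isl y) (u' @ [y])"
    using assms snoc by (simp add: reduced_word_def)
  show ?thesis
  proof (rule letter_mult_Cons_cases[of A B y x "[]"])
    assume "letter_mult A B y [x] = []"
    then show ?thesis using alt mult_eq_append[of u' "[]" A B] snoc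
      by (intro exI[of _ "[]"] exI[of _ "length u'"]) (auto simp: successively_append_iff)
  next
    fix z assume z: "isl z = isl x" and eq: "letter_mult A B y [x] = [z]"
    then have "isl y = isl x"
      using letter_mult_eq_Cons[of "[x]" y A B] by (cases "isl y = isl x") auto
    then have "successively (\<lambda>x y. isl x \<noteq> isl y) (u' @ [z])"
      using alt z by (auto simp: successively_append_iff)
    then show ?thesis using eq mult_eq_append[of u' "[z]" A B] snoc
      by (intro exI[of _ "[z]"] exI[of _ "length u'"]) auto
  next
    assume "isl y \<noteq> isl x"
    then have "successively (\<lambda>x y. isl x \<noteq> isl y) (u @ [x])"
      using alt snoc by (simp add: successively_append_iff)
    then show ?thesis using mult_eq_append[of u "[x]" A B]
      by (intro exI[of _ "[x]"] exI[of _ "length u"]) auto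
  qed
qed

context two_groups
begin

lemma mult_keeps_prefix:
  assumes "reduced_word A B v" "reduced_word A B g"
  shows "\<exists>w i. length v \<le> i + length g \<and> i \<le> length v \<and>
    foldr (letter_mult A B) v g = take i v @ w"
  using assms(2)
proof (induction g rule: rev_induct)
  case Nil
  show ?case using mult_Nil_right[OF assms(1)]
    by (intro exI[of _ "[]"] exI[of _ "length v"]) simp
next
  case (snoc x g)
  then have g: "reduced_word A B g" and x: "reduced_word A B [x]"
    by (auto simp: reduced_word_def successively_append_iff)
  from snoc.IH[OF g] obtain w i where i: "length v \<le> i + length g" "i \<le> length v"
    and eq: "foldr (letter_mult A B) v g = take i v @ w" by blast
  have "foldr (letter_mult A B) g [x] = g @ [x]"
    using snoc.prems by (intro mult_eq_append) (simp add: reduced_word_def)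
  then have prod: "foldr (letter_mult A B) v (g @ [x]) = foldr (letter_mult A B) (take i v @ w) [x]"
    using mult_assoc[OF assms(1) g x] eq by simp
  obtain w' i' where i': "length (take i v @ w) \<le> Suc i'" "i' \<le> length (take i v @ w)"
    and eq': "foldr (letter_mult A B) (take i v @ w) [x] = take i' (take i v @ w) @ w'"
    using mult_last_letter[of A B "take i v @ w" x] reduced_mult[OF assms(1) g] eq by metis
  show ?case using i i' eq' prod
    by (intro exI[of _ "take (i' - i) w @ w'"] exI[of _ "min i i'"]) (auto simp: min_def)
qed

end


section \<open>Alternating words\<close>

definition alternating_word :: "'c \<Rightarrow> 'c \<Rightarrow> nat \<Rightarrow> 'c list" where
  "alternating_word x y n = map (\<lambda>p. if even p then x else y) [0..<n]"

lemma length_alternating_word [simp]: "length (alternating_word x y n) = n"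
  by (simp add: alternating_word_def)

lemma nth_alternating_word [simp]:
  "p < n \<Longrightarrow> alternating_word x y n ! p = (if even p then x else y)"
  by (simp add: alternating_word_def)

lemma alternating_word_Suc_Suc:
  "alternating_word x y (Suc (Suc n)) =
    alternating_word x y n @ (if even n then [x, y] else [y, x])"
  by (simp add: alternating_word_def)

lemma reduced_alternating_word:
  assumes "nontrivial_letter A B x" "nontrivial_letter A B y" "isl x \<noteq> isl y"
  shows "reduced_word A B (alternating_word x y n)"
  using assms by (auto simp: reduced_word_def successively_conv_nth alternating_word_def)

lemma (in two_groups) pow_eq_alternating_word:
  assumes "nontrivial_letter A B x" "nontrivial_letter A B y" "isl x \<noteq> isl y"
  shows "[x, y] [^]\<^bsub>free_product A B\<^esub> (n::nat) = alternating_word x y (2 * n)"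
proof (induction n)
  case 0
  show ?case by (simp add: alternating_word_def nat_pow_def free_product_def)
next
  case (Suc n)
  have eq: "alternating_word x y (2 * Suc n) = alternating_word x y (2 * n) @ [x, y]"
    by (simp add: alternating_word_Suc_Suc)
  have "foldr (letter_mult A B) (alternating_word x y (2 * n)) [x, y] =
      alternating_word x y (2 * n) @ [x, y]"
    using reduced_alternating_word[OF assms, of "2 * Suc n"]
    by (intro mult_eq_append) (simp only: eq reduced_word_def)
  moreover have "[x, y] [^]\<^bsub>free_product A B\<^esub> Suc n =
      foldr (letter_mult A B) ([x, y] [^]\<^bsub>free_product A B\<^esub> n) [x, y]"
    using monoid.nat_pow_Suc[OF group.is_monoid[OF group_free_product[OF A.is_group B.is_group]],
        of "[x, y]" n] by simp
  ultimately show ?case using Suc eq by simp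
qed

lemma alternating_word_overlap:
  assumes "w @ drop j (alternating_word x y n) = take i (alternating_word x' y' m) @ w'"
    and "length w \<le> p" "p < i" "i \<le> m" "p - length w + j < n"
  shows "(if even (p - length w + j) then x else y) = (if even p then x' else y')"
proof -
  have "(w @ drop j (alternating_word x y n)) ! p = (if even (p - length w + j) then x else y)"
    using assms(2-) by (simp add: nth_append add.commute)
  moreover have "(take i (alternating_word x' y' m) @ w') ! p = (if even p then x' else y')"
    using assms(2-) by (simp add: nth_append)
  ultimately show ?thesis using assms(1) by simp
qed

text \<open>
  The short word \<open>w\<close> lies inside the prefix on the right-hand side, so it alternates from its
  first letter on; the one position of overlap beyond \<open>w\<close> forces the suffix to continue with
  the right parity.
\<close>

lemma alternating_word_glue:
  assumes eq: "w @ drop j (alternating_word x y n) = take i (alternating_word x y m) @ w'"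
    and "length w < i" "i \<le> m" "j < n" "x \<noteq> y"
  shows "w @ drop j (alternating_word x y n) = alternating_word x y (length w + (n - j))"
    and "even (length w + j)"
proof -
  show parity: "even (length w + j)"
    using alternating_word_overlap[OF eq, of "length w"] assms by (auto split: if_splits)
  have short: "w ! p = (if even p then x else y)" if "p < length w" for p
  proof -
    have "w ! p = (w @ drop j (alternating_word x y n)) ! p" using that by (simp add: nth_append)
    also have "\<dots> = (if even p then x else y)" using that assms by (simp add: eq nth_append)
    finally show ?thesis .
  qed
  show "w @ drop j (alternating_word x y n) = alternating_word x y (length w + (n - j))"
  proof (rule nth_equalityI)
    fix p assume p: "p < length (w @ drop j (alternating_word x y n))"
    show "(w @ drop j (alternating_word x y n)) ! p =
        alternating_word x y (length w + (n - j)) ! p"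
    proof (cases "p < length w")
      case True
      then show ?thesis using short by (simp add: nth_append)
    next
      case False
      then have "even (j + (p - length w)) \<longleftrightarrow> even p" using parity by auto
      then show ?thesis using False p by (simp add: nth_append)
    qed
  qed (use assms(4) in simp)
qed


section \<open>Conjugating powers of a word of length two\<close>

lemma (in group) conj_pow:
  assumes "g \<in> carrier G" "h \<in> carrier G" "h' \<in> carrier G" "g \<otimes> h = h' \<otimes> g"
  shows "g \<otimes> h [^] (k::nat) = h' [^] k \<otimes> g"
proof (induction k)
  case (Suc k)
  have "g \<otimes> h [^] Suc k = (g \<otimes> h [^] k) \<otimes> h" using assms by (simp add: m_assoc)
  also have "\<dots> = h' [^] k \<otimes> (g \<otimes> h)" using assms Suc by (simp add: m_assoc)
  also have "\<dots> = h' [^] Suc k \<otimes> g" using assms by (simp add: m_assoc)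
  finally show ?case .
qed (use assms in simp)

lemma (in group) mem_generate_singletonI:
  assumes "g \<in> carrier G" "t \<in> carrier G" "g \<otimes> t [^] (n::nat) = t [^] (m::nat)"
  shows "g \<in> generate G {t}"
proof -
  have "g = t [^] m \<otimes> inv (t [^] n)"
    using assms by (simp add: inv_solve_right)
  also have "\<dots> = t [^] (int m - int n)"
    using assms(2) by (simp add: int_pow_diff int_pow_int)
  finally show ?thesis using generate_pow[OF assms(2)] by blast
qed

context two_groups
begin

text \<open>
  The exponents are multiplied by \<open>k = |g| + 1\<close>, which leaves at least two letters of overlap
  between the undisturbed parts of both sides.
\<close>

lemma conj_pow_overlap:
  assumes g: "reduced_word A B g"
    and xy: "nontrivial_letter A B x" "nontrivial_letter A B y" "isl x \<noteq> isl y"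
    and xy': "nontrivial_letter A B x'" "nontrivial_letter A B y'" "isl x' \<noteq> isl y'"
    and "n > 0" "m > 0"
    and conj: "g \<otimes>\<^bsub>free_product A B\<^esub> [x, y] [^]\<^bsub>free_product A B\<^esub> (n::nat) =
      [x', y'] [^]\<^bsub>free_product A B\<^esub> (m::nat) \<otimes>\<^bsub>free_product A B\<^esub> g"
  obtains N M w j i w' where
    "g \<otimes>\<^bsub>free_product A B\<^esub> [x, y] [^]\<^bsub>free_product A B\<^esub> (N::nat) =
      w @ drop j (alternating_word x y (2 * N))"
    "w @ drop j (alternating_word x y (2 * N)) = take i (alternating_word x' y' (2 * M)) @ w'"
    "length w + 2 \<le> i" "i \<le> 2 * M" "j + 2 \<le> 2 * N"
proof -
  interpret F: group "free_product A B" by (intro group_free_product A.is_group B.is_group)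
  define k where "k = Suc (length g)"
  define N where "N = n * k"
  define M where "M = m * k"
  have large: "k \<le> N" "k \<le> M" using assms by (auto simp: N_def M_def)
  have t: "[x, y] \<in> carrier (free_product A B)" "[x', y'] \<in> carrier (free_product A B)"
    using xy xy' by (auto simp: reduced_word_Cons)
  have "g \<otimes>\<^bsub>free_product A B\<^esub> ([x, y] [^]\<^bsub>free_product A B\<^esub> n) [^]\<^bsub>free_product A B\<^esub> k =
      ([x', y'] [^]\<^bsub>free_product A B\<^esub> m) [^]\<^bsub>free_product A B\<^esub> k \<otimes>\<^bsub>free_product A B\<^esub> g"
    using g t conj by (intro F.conj_pow F.nat_pow_closed) (auto simp del: free_product_simps(3))
  then have "g \<otimes>\<^bsub>free_product A B\<^esub> [x, y] [^]\<^bsub>free_product A B\<^esub> N =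
      [x', y'] [^]\<^bsub>free_product A B\<^esub> M \<otimes>\<^bsub>free_product A B\<^esub> g"
    using t by (simp only: F.nat_pow_pow N_def M_def)
  then have eq: "foldr (letter_mult A B) g (alternating_word x y (2 * N)) =
      foldr (letter_mult A B) (alternating_word x' y' (2 * M)) g"
    by (simp add: pow_eq_alternating_word xy xy')
  obtain w j where w: "length w \<le> length g" "j \<le> length g"
    "foldr (letter_mult A B) g (alternating_word x y (2 * N)) =
      w @ drop j (alternating_word x y (2 * N))"
    using mult_keeps_suffix by blast
  obtain i w' where i: "2 * M \<le> i + length g" "i \<le> 2 * M"
    "foldr (letter_mult A B) (alternating_word x' y' (2 * M)) g =
      take i (alternating_word x' y' (2 * M)) @ w'"
    using mult_keeps_prefix[OF reduced_alternating_word[OF xy'] g, of "2 * M"] by auto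
  show thesis
  proof (rule that[of N w j i M w'])
    show "g \<otimes>\<^bsub>free_product A B\<^esub> [x, y] [^]\<^bsub>free_product A B\<^esub> N =
        w @ drop j (alternating_word x y (2 * N))"
      using w by (simp add: pow_eq_alternating_word xy)
  qed (use w i eq large in \<open>auto simp: k_def\<close>)
qed

lemma conj_pow_imp_mem_generate:
  assumes g: "reduced_word A B g"
    and xy: "nontrivial_letter A B x" "nontrivial_letter A B y" "isl x \<noteq> isl y"
    and "n > 0" "m > 0"
    and "g \<otimes>\<^bsub>free_product A B\<^esub> [x, y] [^]\<^bsub>free_product A B\<^esub> (n::nat) =
      [x, y] [^]\<^bsub>free_product A B\<^esub> (m::nat) \<otimes>\<^bsub>free_product A B\<^esub> g"
  shows "g \<in> generate (free_product A B) {[x, y]}"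
proof -
  interpret F: group "free_product A B" by (intro group_free_product A.is_group B.is_group)
  have t: "[x, y] \<in> carrier (free_product A B)" using xy by (auto simp: reduced_word_Cons)
  obtain N M w j i w' where
    prod: "g \<otimes>\<^bsub>free_product A B\<^esub> [x, y] [^]\<^bsub>free_product A B\<^esub> (N::nat) =
      w @ drop j (alternating_word x y (2 * N))"
    and eq: "w @ drop j (alternating_word x y (2 * N)) =
      take i (alternating_word x y (2 * M)) @ w'"
    and "length w + 2 \<le> i" "i \<le> 2 * M" "j + 2 \<le> 2 * N"
    by (rule conj_pow_overlap[OF g xy xy assms(5-7)])
  then have bounds: "length w < i" "i \<le> 2 * M" "j < 2 * N" "x \<noteq> y" using xy by auto
  note glue = alternating_word_glue[OF eq bounds]
  have "even (length w + (2 * N - j))" using glue(2) bounds by auto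
  then obtain q where "length w + (2 * N - j) = 2 * q" by (rule evenE)
  then have "g \<otimes>\<^bsub>free_product A B\<^esub> [x, y] [^]\<^bsub>free_product A B\<^esub> N =
      [x, y] [^]\<^bsub>free_product A B\<^esub> q"
    using prod glue(1) pow_eq_alternating_word[OF xy, of q] by simp
  then show ?thesis using g t by (intro F.mem_generate_singletonI) (simp_all only: free_product_simps)
qed

text \<open>
  Here \<open>[Inr (inv b), Inl (inv a)]\<close> is the inverse of \<open>[Inl a, Inr b]\<close>. In the overlap one side
  alternates between \<open>a\<close> and \<open>b\<close> and the other between \<open>b\<inverse>\<close> and \<open>a\<inverse>\<close>, so a letter of
  \<open>B\<close> would have to satisfy \<open>b = b\<inverse>\<close>.
\<close>

lemma not_conj_pow_inverse:
  assumes g: "reduced_word A B g"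
    and a: "a \<in> carrier A" "a \<noteq> \<one>\<^bsub>A\<^esub>" and b: "b \<in> carrier B" "b \<otimes>\<^bsub>B\<^esub> b \<noteq> \<one>\<^bsub>B\<^esub>"
    and nm: "n > 0" "m > 0"
  shows "g \<otimes>\<^bsub>free_product A B\<^esub> [Inl a, Inr b] [^]\<^bsub>free_product A B\<^esub> (n::nat) \<noteq>
    [Inr (inv\<^bsub>B\<^esub> b), Inl (inv\<^bsub>A\<^esub> a)] [^]\<^bsub>free_product A B\<^esub> (m::nat) \<otimes>\<^bsub>free_product A B\<^esub> g"
    (is "?lhs \<noteq> ?rhs")
proof
  assume conj: "?lhs = ?rhs"
  have ab: "nontrivial_letter A B (Inl a)" "nontrivial_letter A B (Inr b)"
    "isl (Inl a :: 'a + 'b) \<noteq> isl (Inr b :: 'a + 'b)"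
    "nontrivial_letter A B (Inr (inv\<^bsub>B\<^esub> b))" "nontrivial_letter A B (Inl (inv\<^bsub>A\<^esub> a))"
    "isl (Inr (inv\<^bsub>B\<^esub> b) :: 'a + 'b) \<noteq> isl (Inl (inv\<^bsub>A\<^esub> a) :: 'a + 'b)"
    using a b by auto
  obtain N M w j i w' where
    "g \<otimes>\<^bsub>free_product A B\<^esub> [Inl a, Inr b] [^]\<^bsub>free_product A B\<^esub> (N::nat) =
      w @ drop j (alternating_word (Inl a) (Inr b) (2 * N))"
    and eq: "w @ drop j (alternating_word (Inl a) (Inr b) (2 * N)) =
      take i (alternating_word (Inr (inv\<^bsub>B\<^esub> b)) (Inl (inv\<^bsub>A\<^esub> a)) (2 * M)) @ w'"
    and bounds: "length w + 2 \<le> i" "i \<le> 2 * M" "j + 2 \<le> 2 * N"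
    by (rule conj_pow_overlap[OF g ab nm conj])
  \<comment> \<open>Of the two positions after \<open>w\<close>, the even one carries a letter of \<open>B\<close> on the right.\<close>
  define p where "p = (if even (length w) then length w else Suc (length w))"
  have "even p" "length w \<le> p" "p < i" "p - length w + j < 2 * N"
    using bounds by (auto simp: p_def)
  then have "(Inr b :: 'a + 'b) = Inr (inv\<^bsub>B\<^esub> b)"
    using alternating_word_overlap[OF eq, of p] bounds by (auto split: if_splits)
  then show False using b B.r_inv[of b] by simp
qed

text \<open>
  Replacing \<open>n, m\<close> by their negatives inverts both sides of the conjugacy relation, so only the
  sign of \<open>m\<close> relative to that of \<open>n\<close> matters.
\<close>

lemma conj_int_pow_imp_mem_generate:
  assumes g: "reduced_word A B g"
    and a: "a \<in> carrier A" "a \<noteq> \<one>\<^bsub>A\<^esub>" and b: "b \<in> carrier B" "b \<otimes>\<^bsub>B\<^esub> b \<noteq> \<one>\<^bsub>B\<^esub>"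
    and "n \<noteq> 0"
    and conj: "g \<otimes>\<^bsub>free_product A B\<^esub> [Inl a, Inr b] [^]\<^bsub>free_product A B\<^esub> (n::int) =
      [Inl a, Inr b] [^]\<^bsub>free_product A B\<^esub> (m::int) \<otimes>\<^bsub>free_product A B\<^esub> g"
  shows "g \<in> generate (free_product A B) {[Inl a, Inr b]}"
proof -
  interpret F: group "free_product A B" by (intro group_free_product A.is_group B.is_group)
  let ?F = "free_product A B" and ?t = "[Inl a, Inr b] :: ('a + 'b) list"
    and ?s = "[Inr (inv\<^bsub>B\<^esub> b), Inl (inv\<^bsub>A\<^esub> a)] :: ('a + 'b) list"
  have letters: "nontrivial_letter A B (Inl a)" "nontrivial_letter A B (Inr b)"
    "isl (Inl a :: 'a + 'b) \<noteq> isl (Inr b :: 'a + 'b)"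
    using a b by auto
  have gc: "g \<in> carrier ?F" and t: "?t \<in> carrier ?F"
    using g letters by (auto simp: reduced_word_Cons)
  have s: "?s \<in> carrier ?F" using a b by (auto simp: reduced_word_Cons)
  have "?s \<otimes>\<^bsub>?F\<^esub> ?t = \<one>\<^bsub>?F\<^esub>" using a b by simp
  then have inv_t: "inv\<^bsub>?F\<^esub> ?t = ?s" using s t by (intro F.inv_equality)
  have inverse_conj: "g \<otimes>\<^bsub>?F\<^esub> ?t [^]\<^bsub>?F\<^esub> (- k) = ?t [^]\<^bsub>?F\<^esub> (- l) \<otimes>\<^bsub>?F\<^esub> g"
    if rel: "g \<otimes>\<^bsub>?F\<^esub> ?t [^]\<^bsub>?F\<^esub> k = ?t [^]\<^bsub>?F\<^esub> l \<otimes>\<^bsub>?F\<^esub> g" for k l :: int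
  proof -
    let ?u = "?t [^]\<^bsub>?F\<^esub> k" and ?v = "?t [^]\<^bsub>?F\<^esub> l"
    have uv: "?u \<in> carrier ?F" "?v \<in> carrier ?F" using t F.int_pow_closed by blast+
    have "inv\<^bsub>?F\<^esub> ?v \<otimes>\<^bsub>?F\<^esub> (g \<otimes>\<^bsub>?F\<^esub> ?u) = g"
      using uv gc rel F.inv_solve_left F.m_closed by metis
    then have "(inv\<^bsub>?F\<^esub> ?v \<otimes>\<^bsub>?F\<^esub> g) \<otimes>\<^bsub>?F\<^esub> ?u = g"
      using uv gc F.m_assoc F.inv_closed by metis
    then have "inv\<^bsub>?F\<^esub> ?v \<otimes>\<^bsub>?F\<^esub> g = g \<otimes>\<^bsub>?F\<^esub> inv\<^bsub>?F\<^esub> ?u"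
      using uv gc F.inv_solve_right F.m_closed F.inv_closed by metis
    then show ?thesis using t F.int_pow_neg by metis
  qed
  have "\<exists>n' m'. n' > 0 \<and> g \<otimes>\<^bsub>?F\<^esub> ?t [^]\<^bsub>?F\<^esub> (n'::int) = ?t [^]\<^bsub>?F\<^esub> (m'::int) \<otimes>\<^bsub>?F\<^esub> g"
  proof (cases "n > 0")
    case False
    then show ?thesis using inverse_conj[OF conj] \<open>n \<noteq> 0\<close>
      by (intro exI[of _ "- n"] exI[of _ "- m"]) simp
  qed (use conj in blast)
  then obtain n' m' where n': "n' > 0"
    and "g \<otimes>\<^bsub>?F\<^esub> ?t [^]\<^bsub>?F\<^esub> (n'::int) = ?t [^]\<^bsub>?F\<^esub> (m'::int) \<otimes>\<^bsub>?F\<^esub> g" by blast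
  then have conj': "g \<otimes>\<^bsub>?F\<^esub> ?t [^]\<^bsub>?F\<^esub> nat n' = ?t [^]\<^bsub>?F\<^esub> m' \<otimes>\<^bsub>?F\<^esub> g"
    using int_pow_int[of ?F ?t "nat n'"] by simp
  consider "m' > 0" | "m' = 0" | "m' < 0" by linarith
  then show ?thesis
  proof cases
    case 1
    then have "?t [^]\<^bsub>?F\<^esub> m' = ?t [^]\<^bsub>?F\<^esub> nat m'" using int_pow_int[of ?F ?t "nat m'"] by simp
    then show ?thesis
      using conj_pow_imp_mem_generate[OF g letters, of "nat n'" "nat m'"] conj' n' 1 by simp
  next
    case 2
    then have "g \<otimes>\<^bsub>?F\<^esub> ?t [^]\<^bsub>?F\<^esub> nat n' = g"
      using conj' gc int_pow_0 F.l_one by metis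
    then have "?t [^]\<^bsub>?F\<^esub> nat n' = \<one>\<^bsub>?F\<^esub>"
      using gc t F.nat_pow_closed F.r_cancel_one' F.l_cancel_one by metis
    then have "length (alternating_word (Inl a) (Inr b :: 'a + 'b) (2 * nat n')) = 0"
      using pow_eq_alternating_word[OF letters, of "nat n'"] by simp
    then show ?thesis using n' by simp
  next
    case 3
    have "?t [^]\<^bsub>?F\<^esub> m' = inv\<^bsub>?F\<^esub> (?t [^]\<^bsub>?F\<^esub> nat (- m'))"
      by (simp only: int_pow_def2 3 if_True)
    also have "\<dots> = ?s [^]\<^bsub>?F\<^esub> nat (- m')"
      using F.nat_pow_inv[OF t, of "nat (- m')"] unfolding inv_t by (rule sym)
    finally have "g \<otimes>\<^bsub>?F\<^esub> ?t [^]\<^bsub>?F\<^esub> nat n' = ?s [^]\<^bsub>?F\<^esub> nat (- m') \<otimes>\<^bsub>?F\<^esub> g"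
      using conj' by (simp only:)
    then show ?thesis
      using not_conj_pow_inverse[OF g a b, of "nat n'" "nat (- m')"] n' 3 by simp
  qed
qed

end


section \<open>Malnormality\<close>

lemma (in group) malnormal_generate_singletonI:
  assumes t: "t \<in> carrier G"
    and conj: "\<And>g n m. \<lbrakk>g \<in> carrier G; n \<noteq> 0; g \<otimes> t [^] (n::int) = t [^] (m::int) \<otimes> g\<rbrakk>
      \<Longrightarrow> g \<in> generate G {t}"
  shows "malnormal (generate G {t}) G"
  unfolding malnormal_def
proof (intro conjI ballI)
  let ?H = "generate G {t}"
  show sub: "subgroup ?H G" using t by (intro generate_is_subgroup) simp
  fix g assume g: "g \<in> carrier G - ?H"
  show "((g <# ?H) #> inv g) \<inter> ?H = {\<one>}"
  proof (intro equalityI subsetI)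
    fix z assume z: "z \<in> ((g <# ?H) #> inv g) \<inter> ?H"
    then obtain n m :: int where n: "z = g \<otimes> t [^] n \<otimes> inv g" and m: "z = t [^] m"
      using generate_pow[OF t] by (auto simp: l_coset_def r_coset_def)
    then have "g \<otimes> t [^] n = t [^] m \<otimes> g"
      using g t by (metis DiffD1 int_pow_closed inv_solve_right m_closed)
    then have "n = 0" using conj[of g n m] g by blast
    then show "z \<in> {\<one>}" using n g by simp
  next
    fix z assume "z \<in> {\<one>}"
    moreover have "g \<otimes> \<one> \<otimes> inv g = \<one>" using g by simp
    ultimately show "z \<in> ((g <# ?H) #> inv g) \<inter> ?H"
      using subgroup.one_closed[OF sub] by (force simp: l_coset_def r_coset_def)
  qed
qed

theorem corollary4p5:
  fixes A :: "('a, 'm) monoid_scheme" and B :: "('b, 'n) monoid_scheme"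
    and a :: 'a and b :: 'b
  assumes "group A" and "group B"
    and "infinite (carrier A) \<or> card (carrier A) \<ge> 2"
    and "b \<in> carrier B" and "group.ord B b = 0 \<or> group.ord B b \<ge> 3"
    and "a \<in> carrier A" and "a \<noteq> \<one>\<^bsub>A\<^esub>"
  shows "malnormal
    (generate (free_product A B) {free_inl A a \<otimes>\<^bsub>free_product A B\<^esub> free_inr B b})
    (free_product A B)"
proof -
  interpret two_groups A B using assms by (simp add: two_groups_def)
  interpret F: group "free_product A B" using assms by (intro group_free_product)
  have "\<not> B.ord b dvd 2" using assms(5) by (auto dest: dvd_imp_le)
  then have "b [^]\<^bsub>B\<^esub> (2::nat) \<noteq> \<one>\<^bsub>B\<^esub>" using B.pow_eq_id[OF assms(4)] by blast
  then have bb: "b \<otimes>\<^bsub>B\<^esub> b \<noteq> \<one>\<^bsub>B\<^esub>" using assms(4) by (simp add: numeral_2_eq_2)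
  then have b: "b \<noteq> \<one>\<^bsub>B\<^esub>" by auto
  have "malnormal (generate (free_product A B) {[Inl a, Inr b]}) (free_product A B)"
  proof (rule F.malnormal_generate_singletonI)
    show "[Inl a, Inr b] \<in> carrier (free_product A B)"
      using assms b by (simp add: reduced_word_Cons)
  next
    fix g and n m :: int
    assume "g \<in> carrier (free_product A B)" "n \<noteq> 0"
      "g \<otimes>\<^bsub>free_product A B\<^esub> [Inl a, Inr b] [^]\<^bsub>free_product A B\<^esub> n =
        [Inl a, Inr b] [^]\<^bsub>free_product A B\<^esub> m \<otimes>\<^bsub>free_product A B\<^esub> g"
    then show "g \<in> generate (free_product A B) {[Inl a, Inr b]}"
      using conj_int_pow_imp_mem_generate[of g a b n m] assms bb by simp
  qed
  moreover have "free_inl A a \<otimes>\<^bsub>free_product A B\<^esub> free_inr B b = [Inl a, Inr b]"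
    using assms(7) b by (simp add: free_inl_def free_inr_def)
  ultimately show ?thesis by simp
qed

end
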